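(* For all positive integers $r$ and $t$, we have $\operatorname{diam}\big(\mathcal{I}(K_r[\overline{K_t}])\big) = (r-1)t$.
   Context: $K_r[\overline{K_t}]$ denotes the complete $r$-partite graph in which every part has size $t$. In an orientation $\vec{G}$ of a graph $G$, the inversion of a set $X \subseteq V(G)$ consists in reversing all arcs with both endvertices in $X$. The inversion graph $\mathcal{I}(G)$ is the graph whose vertices are the labelled orientations of $G$, two orientations being adjacent if and only if the inversion of some $X\subseteq V(G)$ transforms one into the other; $\operatorname{diam}(\mathcal{I}(G))$ is its diameter. *)

theory Defs
  imports "Graph_Theory.Graph_Theory"
begin

text \<open>
  Following the Graph_Theory entry, an undirected simple graph is a symmetric loopfree digraph
  (\<^locale>\<open>pair_graph\<close>): an edge \<open>uv\<close> is present as both \<open>(u, v)\<close> and \<open>(v, u)\<close>.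
\<close>

definition complete_multipartite :: "nat \<Rightarrow> nat \<Rightarrow> (nat \<times> nat) pair_pre_digraph" where
  \<comment> \<open>\<open>(i, a)\<close> is the \<open>a\<close>-th vertex of the \<open>i\<close>-th part\<close>
  "complete_multipartite r t =
     \<lparr> pverts = {..<r} \<times> {..<t},
       parcs = {(u, v). u \<in> {..<r} \<times> {..<t} \<and> v \<in> {..<r} \<times> {..<t} \<and> fst u \<noteq> fst v} \<rparr>"

definition orientations :: "'a pair_pre_digraph \<Rightarrow> 'a pair_pre_digraph set" where
  "orientations G =
     {D. pverts D = pverts G \<and> parcs D \<union> (parcs D)\<inverse> = parcs G \<and> parcs D \<inter> (parcs D)\<inverse> = {}}"

definition invert :: "'a set \<Rightarrow> 'a pair_pre_digraph \<Rightarrow> 'a pair_pre_digraph" where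
  "invert X D = D \<lparr> parcs := (parcs D - X \<times> X) \<union> (parcs D \<inter> X \<times> X)\<inverse> \<rparr>"

text \<open>
  Inversions that change nothing would give loops; they are excluded, so that the result is again
  a simple graph. Distances are not affected by this.
\<close>

definition inversion_graph :: "'a pair_pre_digraph \<Rightarrow> 'a pair_pre_digraph pair_pre_digraph" where
  "inversion_graph G =
     \<lparr> pverts = orientations G,
       parcs = {(D, D'). D \<in> orientations G \<and> D' \<in> orientations G \<and> D \<noteq> D' \<and>
                         (\<exists>X \<subseteq> pverts G. D' = invert X D)} \<rparr>"

text \<open>
  With unit weights, the shortest-path cost \<^const>\<open>wf_digraph.\<mu>\<close> is the usual graph distance,
  with value \<open>\<infinity>\<close> if there is no walk.
\<close>

definition diam :: "('a, 'b) pre_digraph \<Rightarrow> ereal" where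
  "diam G = (SUP u\<in>verts G. SUP v\<in>verts G. wf_digraph.\<mu> G (\<lambda>_. 1) u v)"

lemma pair_graph_complete_multipartite: "pair_graph (complete_multipartite r t)"
proof -
  have "finite (parcs (complete_multipartite r t))"
    by (rule finite_subset[of _ "({..<r} \<times> {..<t}) \<times> ({..<r} \<times> {..<t})"])
       (auto simp: complete_multipartite_def)
  then show ?thesis
    by unfold_locales
       (auto simp: complete_multipartite_def symmetric_def sym_def)
qed

lemma invert_invert: "invert X (invert X D) = D"
  by (auto simp: invert_def intro!: pair_pre_digraph.equality)

lemma invert_orientations:
  assumes "D \<in> orientations G"
  shows "invert X D \<in> orientations G"
proof -
  have "parcs (invert X D) \<union> (parcs (invert X D))\<inverse> = parcs D \<union> (parcs D)\<inverse>"
    by (auto simp: invert_def)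
  moreover have "parcs (invert X D) \<inter> (parcs (invert X D))\<inverse> = {}"
    using assms by (auto simp: invert_def orientations_def)
  moreover have "pverts (invert X D) = pverts D"
    by (simp add: invert_def)
  ultimately show ?thesis
    using assms by (simp add: orientations_def)
qed

lemma pair_graph_inversion_graph:
  assumes "pair_graph G"
  shows "pair_graph (inversion_graph G)"
proof -
  interpret G: pair_graph G by fact
  have "orientations G \<subseteq> (\<lambda>A. \<lparr> pverts = pverts G, parcs = A \<rparr>) ` Pow (parcs G)"
    by (auto simp: orientations_def image_iff intro!: pair_pre_digraph.equality)
  then have fin: "finite (orientations G)"
    by (rule finite_subset) (simp add: G.pair_finite_arcs)
  have "finite (parcs (inversion_graph G))"
    by (rule finite_subset[of _ "orientations G \<times> orientations G"])
       (auto simp: inversion_graph_def fin)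
  moreover have "sym (parcs (inversion_graph G))"
    by (rule symI) (auto simp: inversion_graph_def invert_invert)
  ultimately show ?thesis
    by unfold_locales (auto simp: inversion_graph_def fin symmetric_def)
qed

lemma wf_digraph_inversion_graph: "wf_digraph (with_proj (inversion_graph G))"
  by unfold_locales (auto simp: inversion_graph_def)

lemma diam_inversion_graph:
  "diam (with_proj (inversion_graph G)) =
     (SUP D\<in>orientations G. SUP D'\<in>orientations G.
        INF p\<in>{p. pre_digraph.awalk (with_proj (inversion_graph G)) D p D'}. ereal (length p))"
proof -
  interpret wf_digraph "with_proj (inversion_graph G)" by (rule wf_digraph_inversion_graph)
  have "awalk_cost (\<lambda>_. 1) p = length p" for p
    by (simp add: awalk_cost_def sum_list_triv)
  then show ?thesis
    by (simp add: diam_def \<mu>_def) (simp add: inversion_graph_def)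
qed

end

theory Submission
  imports Defs
begin

text \<open>
  Upper bound: make the arcs at the vertices of the first \<open>r - 1\<close> parts correct one vertex at a
  time, inverting \<open>u\<close> together with those remaining vertices that are joined to \<open>u\<close> by a wrong arc.
  No arc lies inside the last part, so \<open>(r - 1) t\<close> inversions suffice.

  Lower bound: reverse exactly the arcs between \<open>(i, a)\<close> and \<open>(i + 1, a)\<close>. If \<open>k\<close> inversions do
  this, let the vector of a vertex \<open>v\<close>, of length \<open>k\<close> over the field with two elements, record
  which inverted sets contain \<open>v\<close>; an arc is reversed iff the vectors of its ends have inner product 1. Pairing
  with the vectors of \<open>(i + 1, a)\<close> is triangular, so the vectors of the \<open>(i, a)\<close> with
  \<open>i < r - 1\<close> are linearly independent, whence \<open>(r - 1) t \<le> k\<close>.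
\<close>

section \<open>Orientations and the effect of inversions on a single arc\<close>

lemma converse_arc_orientation:
  assumes "D \<in> orientations G" "(u, v) \<in> parcs G"
  shows "(v, u) \<in> parcs D \<longleftrightarrow> (u, v) \<notin> parcs D"
  using assms by (auto simp: orientations_def)

lemma arc_sym_if_orientation:
  assumes "D \<in> orientations G" "(u, v) \<in> parcs G"
  shows "(v, u) \<in> parcs G"
proof -
  have "parcs G = parcs D \<union> (parcs D)\<inverse>"
    using assms(1) by (simp add: orientations_def)
  with assms(2) show ?thesis by auto
qed

lemma parcs_orientation_subset: "D \<in> orientations G \<Longrightarrow> parcs D \<subseteq> parcs G"
  by (auto simp: orientations_def)

lemma orientation_eqI:
  assumes "D \<in> orientations G" "D' \<in> orientations G"
    and "\<And>u v. (u, v) \<in> parcs G \<Longrightarrow> (u, v) \<in> parcs D \<longleftrightarrow> (u, v) \<in> parcs D'"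
  shows "D = D'"
proof (rule pair_pre_digraph.equality)
  show "pverts D = pverts D'"
    using assms(1,2) by (simp add: orientations_def)
  show "parcs D = parcs D'"
    using assms(3) parcs_orientation_subset[OF assms(1)] parcs_orientation_subset[OF assms(2)]
    by auto
qed simp

lemma arc_invert_iff:
  assumes "D \<in> orientations G" "(u, v) \<in> parcs G"
  shows "(u, v) \<in> parcs (invert X D) \<longleftrightarrow> ((u, v) \<in> parcs D \<longleftrightarrow> \<not> (u \<in> X \<and> v \<in> X))"
  using converse_arc_orientation[OF assms] by (auto simp: invert_def)

lemma fold_invert_orientations:
  "D \<in> orientations G \<Longrightarrow> fold invert Xs D \<in> orientations G"
  by (induction Xs arbitrary: D) (auto simp: invert_orientations)

text \<open>Each inverted set containing both ends flips the arc once, so only a parity matters.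
  Positions \<open>l\<close> are counted instead of sets because a set may occur repeatedly in
  \<open>Xs\<close>; modulo 2 the count is the inner product of the vectors of \<open>u\<close> and
  \<open>v\<close>.\<close>

lemma arc_fold_invert_iff:
  assumes "D \<in> orientations G" "(u, v) \<in> parcs G"
  shows "(u, v) \<in> parcs (fold invert Xs D) \<longleftrightarrow>
    ((u, v) \<in> parcs D \<longleftrightarrow> even (card {l. l < length Xs \<and> u \<in> Xs ! l \<and> v \<in> Xs ! l}))"
proof -
  have "(u, v) \<in> parcs (fold invert Xs D) \<longleftrightarrow>
    ((u, v) \<in> parcs D \<longleftrightarrow> even (length (filter (\<lambda>X. u \<in> X \<and> v \<in> X) Xs)))"
    using assms(1)
  proof (induction Xs arbitrary: D)
    case (Cons X Xs)
    then show ?case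
      using arc_invert_iff[OF Cons.prems assms(2), of X] by (auto simp: invert_orientations)
  qed simp
  then show ?thesis
    by (simp add: length_filter_conv_card)
qed

section \<open>Walks in the inversion graph and sequences of inversions\<close>

lemma awalk_inversion_graph_imp_fold:
  assumes "pre_digraph.awalk (with_proj (inversion_graph G)) D p D'"
  shows "\<exists>Xs. length Xs = length p \<and> D' = fold invert Xs D"
  using assms
proof (induction p arbitrary: D)
  case Nil
  interpret wf_digraph "with_proj (inversion_graph G)" by (rule wf_digraph_inversion_graph)
  from Nil show ?case by (simp add: awalk_Nil_iff)
next
  case (Cons e p)
  interpret wf_digraph "with_proj (inversion_graph G)" by (rule wf_digraph_inversion_graph)
  from Cons.prems have e: "e \<in> parcs (inversion_graph G)" "D = fst e" "awalk (snd e) p D'"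
    by (auto simp: awalk_Cons_iff)
  then obtain X where X: "snd e = invert X D"
    by (auto simp: inversion_graph_def)
  from Cons.IH[OF e(3)] obtain Xs where "length Xs = length p" "D' = fold invert Xs (snd e)"
    by blast
  then have "length (X # Xs) = length (e # p) \<and> D' = fold invert (X # Xs) D"
    by (simp add: X)
  then show ?case by blast
qed

text \<open>The walk may be shorter than \<open>Xs\<close>: the inversion graph has no loops, so an
  inversion that changes nothing contributes no arc.\<close>

lemma ex_awalk_fold_invert:
  assumes "D \<in> orientations G" "\<And>X. X \<in> set Xs \<Longrightarrow> X \<subseteq> pverts G"
  shows "\<exists>p. pre_digraph.awalk (with_proj (inversion_graph G)) D p (fold invert Xs D) \<and>
    length p \<le> length Xs"
  using assms
proof (induction Xs arbitrary: D)
  case Nil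
  interpret wf_digraph "with_proj (inversion_graph G)" by (rule wf_digraph_inversion_graph)
  have "D \<in> verts (with_proj (inversion_graph G))"
    using Nil.prems(1) by (simp add: inversion_graph_def)
  then show ?case by (simp add: awalk_Nil_iff)
next
  case (Cons X Xs)
  interpret wf_digraph "with_proj (inversion_graph G)" by (rule wf_digraph_inversion_graph)
  have D1: "invert X D \<in> orientations G"
    using Cons.prems(1) by (rule invert_orientations)
  from Cons.IH[OF D1] Cons.prems(2) obtain p where
    p: "awalk (invert X D) p (fold invert Xs (invert X D))" "length p \<le> length Xs"
    by auto
  show ?case
  proof (cases "invert X D = D")
    case True
    with p show ?thesis by (auto intro: exI[of _ p])
  next
    case False
    with Cons.prems D1 have "(D, invert X D) \<in> parcs (inversion_graph G)"
      by (auto simp: inversion_graph_def)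
    with p Cons.prems(1) have "awalk D ((D, invert X D) # p) (fold invert (X # Xs) D)"
      by (simp add: awalk_Cons_iff)
    with p(2) show ?thesis
      by (intro exI[of _ "(D, invert X D) # p"]) simp
  qed
qed

section \<open>Upper bound from a vertex cover\<close>

text \<open>Invariant of the induction: \<open>D\<close> and \<open>D'\<close> can differ only on
  arcs inside \<open>S\<close>, and \<open>U\<close> meets every such arc. Treating a vertex removes
  it from both \<open>S\<close> and \<open>U\<close>, so the independent set \<open>S - U\<close>
  stays the same.\<close>

lemma ex_inversions_cover:
  assumes "finite U" "U \<subseteq> S" "S \<subseteq> pverts G"
    and "D \<in> orientations G" and D': "D' \<in> orientations G"
    and "\<And>u. (u, u) \<notin> parcs G"
    and "\<And>u v. \<lbrakk>(u, v) \<in> parcs G; \<not> (u \<in> S \<and> v \<in> S)\<rbrakk> \<Longrightarrow> (u, v) \<in> parcs D \<longleftrightarrow> (u, v) \<in> parcs D'"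
    and "\<And>u v. \<lbrakk>u \<in> S - U; v \<in> S - U\<rbrakk> \<Longrightarrow> (u, v) \<notin> parcs G"
  shows "\<exists>Xs. length Xs = card U \<and> (\<forall>X\<in>set Xs. X \<subseteq> pverts G) \<and> fold invert Xs D = D'"
  using assms(1-4,7,8)
proof (induction U arbitrary: S D rule: finite_induct)
  case empty
  have "D = D'"
    using empty.prems(4,5) by (intro orientation_eqI[OF empty.prems(3) D']) blast
  then show ?case by simp
next
  case (insert u U)
  \<comment> \<open>Inverting \<open>X\<close> may also flip arcs between other members of
    \<open>X\<close>. These lie inside \<open>S - {u}\<close>, where the induction hypothesis
    tolerates any disagreement.\<close>
  define X where
    "X = insert u {w \<in> S. (u, w) \<in> parcs G \<and> ((u, w) \<in> parcs D \<longleftrightarrow> (u, w) \<notin> parcs D')}"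
  have XS: "X \<subseteq> S"
    using insert.prems(1) by (auto simp: X_def)
  have uX: "u \<in> X" by (simp add: X_def)
  note D = insert.prems(3)
  have at_u: "(u, w) \<in> parcs (invert X D) \<longleftrightarrow> (u, w) \<in> parcs D'" if "(u, w) \<in> parcs G" for w
  proof -
    have "w \<noteq> u" using that assms(6) by blast
    then show ?thesis
      using that insert.prems(4)[of u w] uX
      by (auto simp: arc_invert_iff[OF D] X_def)
  qed
  have agree: "(v, w) \<in> parcs (invert X D) \<longleftrightarrow> (v, w) \<in> parcs D'"
    if vw: "(v, w) \<in> parcs G" "\<not> (v \<in> S - {u} \<and> w \<in> S - {u})" for v w
  proof -
    consider "v = u" | "w = u" | "\<not> (v \<in> S \<and> w \<in> S)"
      using vw(2) by blast
    then show ?thesis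
    proof cases
      case 1
      then show ?thesis using at_u vw(1) by simp
    next
      case 2
      \<comment> \<open>An orientation contains exactly one of \<open>(u, v)\<close> and
        \<open>(v, u)\<close>, so agreement on arcs out of \<open>u\<close> gives agreement on arcs
        into \<open>u\<close>.\<close>
      have uv: "(u, v) \<in> parcs G"
        using arc_sym_if_orientation[OF D vw(1)] 2 by simp
      show ?thesis
        using at_u[OF uv] converse_arc_orientation[OF D' uv]
          converse_arc_orientation[OF invert_orientations[OF D] uv] 2 by simp
    next
      case 3
      then have "\<not> (v \<in> X \<and> w \<in> X)" using XS by blast
      then show ?thesis
        using insert.prems(4)[OF vw(1) 3] by (simp add: arc_invert_iff[OF D vw(1)])
    qed
  qed
  have "\<exists>Xs. length Xs = card U \<and> (\<forall>X\<in>set Xs. X \<subseteq> pverts G) \<and> fold invert Xs (invert X D) = D'"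
  proof (rule insert.IH[of "S - {u}"])
    show "U \<subseteq> S - {u}" "S - {u} \<subseteq> pverts G"
      using insert.prems(1,2) insert.hyps(2) by auto
  qed (use agree insert.prems(5) in \<open>auto intro: invert_orientations[OF D]\<close>)
  then obtain Xs where "length Xs = card U" "\<forall>X\<in>set Xs. X \<subseteq> pverts G"
    "fold invert Xs (invert X D) = D'" by blast
  with XS insert.prems(2) insert.hyps show ?case
    by (intro exI[of _ "X # Xs"]) auto
qed

section \<open>Lower bound from a triangular system\<close>

text \<open>Linear independence is expressed by counting: distinct subsets of \<open>U\<close> have
  distinct vector sums over the field with two elements, so \<open>2 ^ card U\<close> is at most
  \<open>2 ^ length Xs\<close>. The vertex \<open>s u\<close> is the partner whose vector pairs to 1
  with that of \<open>u\<close> and to 0 with those of the other \<open>v\<close> satisfying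
  \<open>h v \<le> h u\<close>.\<close>

lemma card_le_inversions_triangular:
  fixes h :: "'a \<Rightarrow> nat"
  assumes D: "D \<in> orientations G" and fin: "finite U"
    and arc: "\<And>u v. \<lbrakk>u \<in> U; v \<in> U; h v \<le> h u\<rbrakk> \<Longrightarrow> (v, s u) \<in> parcs G"
    and tri: "\<And>u v. \<lbrakk>u \<in> U; v \<in> U; h v \<le> h u\<rbrakk> \<Longrightarrow>
      ((v, s u) \<in> parcs D \<longleftrightarrow> (v, s u) \<in> parcs (fold invert Xs D)) \<longleftrightarrow> v \<noteq> u"
  shows "card U \<le> length Xs"
proof -
  define k where "k = length Xs"
  \<comment> \<open>\<open>f S\<close> is the support of the sum modulo 2 of the vectors of the
    vertices in \<open>S\<close>.\<close>
  define f where "f S = {l. l < k \<and> odd (card (S \<inter> Xs ! l))}" for S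
  have "inj_on f (Pow U)"
  proof (rule inj_onI, rule ccontr)
    fix S S' assume S: "S \<in> Pow U" "S' \<in> Pow U" and eq: "f S = f S'" and ne: "S \<noteq> S'"
    \<comment> \<open>Symmetric difference is addition modulo 2, so equal sums for \<open>S\<close>
      and \<open>S'\<close> make the vectors over \<open>T\<close> sum to zero: a linear
      dependency.\<close>
    define T where "T = (S - S') \<union> (S' - S)"
    have TU: "T \<subseteq> U" using S by (auto simp: T_def)
    have finT: "finite T" using TU fin by (rule finite_subset)
    have evenT: "even (card (T \<inter> Xs ! l))" if "l < k" for l
    proof -
      let ?X = "Xs ! l"
      have finS: "finite S" "finite S'" using S fin by (auto intro: finite_subset)
      have "card (S \<inter> ?X) = card ((S - S') \<inter> ?X) + card (S \<inter> S' \<inter> ?X)"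
        using finS by (subst card_Un_disjoint[symmetric]) (auto intro: arg_cong[where f = card])
      moreover have "card (S' \<inter> ?X) = card ((S' - S) \<inter> ?X) + card (S \<inter> S' \<inter> ?X)"
        using finS by (subst card_Un_disjoint[symmetric]) (auto intro: arg_cong[where f = card])
      moreover have "card (T \<inter> ?X) = card ((S - S') \<inter> ?X) + card ((S' - S) \<inter> ?X)"
        using finS unfolding T_def
        by (subst card_Un_disjoint[symmetric]) (auto intro: arg_cong[where f = card])
      moreover have "even (card (S \<inter> ?X)) \<longleftrightarrow> even (card (S' \<inter> ?X))"
        using eq that by (auto simp: f_def)
      ultimately show ?thesis by (metis even_add)
    qed
    \<comment> \<open>Choosing \<open>u\<close> with \<open>h\<close> maximal on \<open>T\<close>
      makes the triangular condition at \<open>s u\<close> available for every member of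
      \<open>T\<close>.\<close>
    have "T \<noteq> {}" using ne by (auto simp: T_def)
    then have "Max (h ` T) \<in> h ` T" using finT by simp
    then obtain u where u: "u \<in> T" and "Max (h ` T) = h u" by blast
    then have max: "h v \<le> h u" if "v \<in> T" for v
      using Max_ge[of "h ` T" "h v"] finT that by simp
    define c where "c v = card {l. l < k \<and> v \<in> Xs ! l \<and> s u \<in> Xs ! l}" for v
    have c: "odd (c v) \<longleftrightarrow> v = u" if "v \<in> T" for v
      using arc_fold_invert_iff[OF D arc, of u v Xs] tri[of u v] u that TU max[OF that]
      by (auto simp: c_def k_def)
    \<comment> \<open>Double counting pairs the vanishing sum over \<open>T\<close> with the vector
      of \<open>s u\<close>. By positions the total is even; by vertices it is odd, since
      \<open>c u\<close> is the only odd term.\<close>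
    have "(\<Sum>l | l < k \<and> s u \<in> Xs ! l. card (T \<inter> Xs ! l)) =
      (\<Sum>l | l < k \<and> s u \<in> Xs ! l. \<Sum>v\<in>T. of_bool (v \<in> Xs ! l))"
      using finT by (simp add: Int_def)
    also have "\<dots> = (\<Sum>v\<in>T. \<Sum>l | l < k \<and> s u \<in> Xs ! l. of_bool (v \<in> Xs ! l))"
      by (rule sum.swap)
    also have "\<dots> = (\<Sum>v\<in>T. c v)"
      by (rule sum.cong)
        (auto simp: c_def Int_def intro!: arg_cong[where f = card])
    also have "\<dots> = c u + (\<Sum>v\<in>T - {u}. c v)"
      using finT u by (rule sum.remove)
    finally have "(\<Sum>l | l < k \<and> s u \<in> Xs ! l. card (T \<inter> Xs ! l)) = c u + (\<Sum>v\<in>T - {u}. c v)" .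
    moreover have "even (\<Sum>l | l < k \<and> s u \<in> Xs ! l. card (T \<inter> Xs ! l))"
      using evenT by (intro dvd_sum) auto
    moreover have "even (\<Sum>v\<in>T - {u}. c v)"
      using c by (intro dvd_sum) auto
    ultimately show False using c[OF u] by simp
  qed
  moreover have "f ` Pow U \<subseteq> Pow {..<k}"
    by (auto simp: f_def)
  ultimately have "card (Pow U) \<le> card (Pow {..<k})"
    by (intro card_inj_on_le) auto
  then show ?thesis
    by (simp add: card_Pow fin k_def)
qed

section \<open>Both bounds for complete multipartite graphs\<close>

lemma inversion_distance_complete_multipartite_le:
  assumes "r \<ge> 1"
    and D: "D \<in> orientations (complete_multipartite r t)"
    and D': "D' \<in> orientations (complete_multipartite r t)"
  shows "\<exists>p. pre_digraph.awalk (with_proj (inversion_graph (complete_multipartite r t))) D p D' \<and>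
    length p \<le> (r - 1) * t"
proof -
  let ?G = "complete_multipartite r t"
  have "\<exists>Xs. length Xs = card ({..<r - 1} \<times> {..<t}) \<and> (\<forall>X\<in>set Xs. X \<subseteq> pverts ?G) \<and>
    fold invert Xs D = D'"
    \<comment> \<open>With \<open>S\<close> the whole vertex set, no agreement is required at the
      start, and \<open>S - U\<close> is the last part.\<close>
    by (rule ex_inversions_cover[where S = "pverts ?G", OF _ _ _ D D'])
      (auto simp: complete_multipartite_def)
  then obtain Xs where "length Xs = (r - 1) * t" "\<forall>X\<in>set Xs. X \<subseteq> pverts ?G"
    "fold invert Xs D = D'" by (auto simp: card_cartesian_product)
  then show ?thesis
    using ex_awalk_fold_invert[OF D, of Xs] by auto
qed

lemma ex_far_orientations_complete_multipartite:
  "\<exists>D\<in>orientations (complete_multipartite r t). \<exists>D'\<in>orientations (complete_multipartite r t).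
     \<forall>p. pre_digraph.awalk (with_proj (inversion_graph (complete_multipartite r t))) D p D' \<longrightarrow>
       (r - 1) * t \<le> length p"
proof -
  let ?G = "complete_multipartite r t"
  define D where "D = \<lparr> pverts = pverts ?G, parcs = {(u, v) \<in> parcs ?G. fst u < fst v} \<rparr>"
  \<comment> \<open>\<open>F u v\<close> says that \<open>v\<close> is the copy of \<open>u\<close>
    in the next part. \<open>D\<close> directs all arcs towards higher parts, and \<open>D'\<close>
    reverses exactly those along \<open>F\<close>.\<close>
  define F where "F u v \<longleftrightarrow> fst v = Suc (fst u) \<and> snd u = snd v" for u v :: "nat \<times> nat"
  define D' where "D' = \<lparr> pverts = pverts ?G,
    parcs = {(u, v) \<in> parcs ?G. fst u < fst v \<and> \<not> F u v \<or> F v u} \<rparr>"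
  have D: "D \<in> orientations ?G"
    by (auto simp: D_def orientations_def complete_multipartite_def)
  have D': "D' \<in> orientations ?G"
    by (auto simp: D'_def F_def orientations_def complete_multipartite_def)
  have "(r - 1) * t \<le> length p"
    if walk: "pre_digraph.awalk (with_proj (inversion_graph ?G)) D p D'" for p
  proof -
    obtain Xs where Xs: "length Xs = length p" "D' = fold invert Xs D"
      using awalk_inversion_graph_imp_fold[OF walk] by blast
    have "card ({..<r - 1} \<times> {..<t}) \<le> length Xs"
    \<comment> \<open>The partner of \<open>u\<close> is its copy in the next part, which exists
      because \<open>u\<close> avoids the last part. If \<open>v\<close> lies in no later part than
      \<open>u\<close>, its arc to this partner goes upwards in \<open>D\<close> and is reversed in
      \<open>D'\<close> only for \<open>v = u\<close>.\<close>
    proof (rule card_le_inversions_triangular[OF D, where h = fst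
          and s = "\<lambda>u. (Suc (fst u), snd u)"])
      fix u v assume "u \<in> {..<r - 1} \<times> {..<t}" "v \<in> {..<r - 1} \<times> {..<t}" "fst v \<le> fst u"
      then show arc: "(v, (Suc (fst u), snd u)) \<in> parcs ?G"
        by (auto simp: complete_multipartite_def)
      show "((v, (Suc (fst u), snd u)) \<in> parcs D \<longleftrightarrow>
          (v, (Suc (fst u), snd u)) \<in> parcs (fold invert Xs D)) \<longleftrightarrow> v \<noteq> u"
        using arc \<open>fst v \<le> fst u\<close> unfolding Xs(2)[symmetric]
        by (auto simp: D_def D'_def F_def prod_eq_iff)
    qed simp
    then show ?thesis by (simp add: Xs(1) card_cartesian_product)
  qed
  with D D' show ?thesis by blast
qed

theorem theorem2p3:
  fixes r t :: nat
  assumes "r \<ge> 1" and "t \<ge> 1"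
  shows "diam (with_proj (inversion_graph (complete_multipartite r t))) = ereal (real ((r - 1) * t))"
  unfolding diam_inversion_graph
proof (rule antisym)
  let ?G = "complete_multipartite r t"
  let ?W = "\<lambda>D D'. {p. pre_digraph.awalk (with_proj (inversion_graph ?G)) D p D'}"
  show "(SUP D\<in>orientations ?G. SUP D'\<in>orientations ?G. INF p\<in>?W D D'. ereal (length p))
      \<le> ereal (real ((r - 1) * t))"
  proof (intro SUP_least)
    fix D D' assume "D \<in> orientations ?G" "D' \<in> orientations ?G"
    then obtain p where "p \<in> ?W D D'" "length p \<le> (r - 1) * t"
      using inversion_distance_complete_multipartite_le[OF assms(1)] by blast
    then show "(INF p\<in>?W D D'. ereal (length p)) \<le> ereal (real ((r - 1) * t))"
      by (intro INF_lower2[of p]) (simp_all only: ereal_less_eq of_nat_le_iff)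
  qed
  obtain D D' where D: "D \<in> orientations ?G" "D' \<in> orientations ?G"
    and far: "\<And>p. p \<in> ?W D D' \<Longrightarrow> (r - 1) * t \<le> length p"
    using ex_far_orientations_complete_multipartite[of r t] by blast
  have "ereal (real ((r - 1) * t)) \<le> (INF p\<in>?W D D'. ereal (length p))"
    using far by (intro INF_greatest) (simp only: ereal_less_eq of_nat_le_iff)
  then show "ereal (real ((r - 1) * t)) \<le>
      (SUP D\<in>orientations ?G. SUP D'\<in>orientations ?G. INF p\<in>?W D D'. ereal (length p))"
    by (intro SUP_upper2[OF D(1)] SUP_upper2[OF D(2)])
qed

end
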